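(* Let $G$ be a tame graph, $g:G\to G$ a continuous mixing map with countable Markov partition $\mathcal P$, and let $M$ be the associated transition matrix. Then $(G,g)$ is isomorphic modulo countable invariant sets to the shift space $(\Sigma_M,\sigma)$.
   Context: A continuum is a nonempty, compact, connected metric space. For a continuum $G$, $E(G)$ is the set of endpoints, i.e. points having arbitrarily small neighborhoods $V$ with $\#\partial V=1$; $B(G)$ is the set of branching points, i.e. points $x$ such that any sufficiently small neighborhood $V$ of $x$ has $\#\partial V\ge3$. $G$ is a tame graph if $E(G)\cup B(G)$ has countable closure. An arc $\alpha\subset G$ is a free arc if $\alpha^\circ=\alpha\setminus E(\alpha)$ (the arc without its two endpoints) is open in $G$. A tame partition for $G$ is a countable family $\mathcal P$ of free arcs with pairwise disjoint interiors $\alpha^\circ$ covering $G$ up to a countable set of points. Let $g:G\to G$ be continuous. A tame partition $\mathcal P$ is a countable Markov partition for $g$ if for every $i\in\mathcal P$ the restriction $g|_i:i\to g(i)$ is a homeomorphism, and for all $i,j\in\mathcal P$, $g(i)\cap j^\circ\ne\emptyset$ implies $g(i)\supset j$. The transition matrix is $M=(m_{ij})_{i,j\in\mathcal P}$ with $m_{ij}=1$ if $g(i)\supset j$ and $m_{ij}=0$ if $g(i)\cap j^\circ=\emptyset$. The map $g$ is mixing if for each pair of nonempty open sets $U,V\subset G$ there is $N\ge0$ such that $g^n(U)\cap V\ne\emptyset$ for all $n\ge N$. $\Sigma_M=\{i_0i_1i_2\cdots\in\mathcal P^{\mathbb N_0}:m_{i_ni_{n+1}}=1\ \forall n\}$ is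 the one-sided Markov shift space with the topology generated by cylinder sets, and $\sigma$ is the left shift. A set $B$ is totally invariant for $f:X\to X$ if $f^{-1}(B)=B$. Two systems $(X_1,f_1)$, $(X_2,f_2)$ are isomorphic modulo countable invariant sets if there exist totally invariant countable sets $N_1\subset X_1$, $N_2\subset X_2$ and a bijection $\psi:X_1\setminus N_1\to X_2\setminus N_2$, bimeasurable with respect to the Borel $\sigma$-algebras, such that $f_2\circ\psi=\psi\circ f_1$. *)

theory Defs
  imports "HOL-Analysis.Analysis"
begin

text \<open>
  Continua are modelled as subsets \<open>G\<close> of a metric space; all topological notions
  (neighbourhoods, boundary, closure, openness) are relative to the subspace \<open>G\<close>.
\<close>

definition continuum :: "'a::metric_space set \<Rightarrow> bool" where
  "continuum G \<longleftrightarrow> G \<noteq> {} \<and> compact G \<and> connected G"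

text \<open>Neighbourhoods need not be open.\<close>

definition nbhd_in :: "'a::metric_space set \<Rightarrow> 'a \<Rightarrow> 'a set \<Rightarrow> bool" where
  "nbhd_in G x V \<longleftrightarrow> V \<subseteq> G \<and> x \<in> (top_of_set G) interior_of V"

definition endpoints :: "'a::metric_space set \<Rightarrow> 'a set" where
  "endpoints G = {x \<in> G. \<forall>e>0. \<exists>V. nbhd_in G x V \<and> V \<subseteq> ball x e \<and>
                            card ((top_of_set G) frontier_of V) = 1}"

text \<open>An infinite boundary has \<open>card\<close> equal to \<open>0\<close>, so it is listed separately.\<close>

definition branching_points :: "'a::metric_space set \<Rightarrow> 'a set" where
  "branching_points G = {x \<in> G. \<exists>e>0. \<forall>V. nbhd_in G x V \<and> V \<subseteq> ball x e \<longrightarrow>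
                            infinite ((top_of_set G) frontier_of V) \<or>
                            card ((top_of_set G) frontier_of V) \<ge> 3}"

definition tame_graph :: "'a::metric_space set \<Rightarrow> bool" where
  "tame_graph G \<longleftrightarrow> continuum G \<and>
     countable ((top_of_set G) closure_of (endpoints G \<union> branching_points G))"

definition is_arc :: "'a::metric_space set \<Rightarrow> bool" where
  "is_arc \<alpha> \<longleftrightarrow> (\<exists>\<gamma>. arc \<gamma> \<and> path_image \<gamma> = \<alpha>)"

text \<open>
  Here \<^term>\<open>endpoints \<alpha>\<close> is taken in the continuum \<open>\<alpha>\<close> itself, not in an ambient graph;
  for an arc these are its two end points.
\<close>

definition arc_interior :: "'a::metric_space set \<Rightarrow> 'a set" where
  "arc_interior \<alpha> = \<alpha> - endpoints \<alpha>"

definition free_arc :: "'a::metric_space set \<Rightarrow> 'a set \<Rightarrow> bool" where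
  "free_arc G \<alpha> \<longleftrightarrow> is_arc \<alpha> \<and> \<alpha> \<subseteq> G \<and> openin (top_of_set G) (arc_interior \<alpha>)"

definition tame_partition :: "'a::metric_space set \<Rightarrow> 'a set set \<Rightarrow> bool" where
  "tame_partition G P \<longleftrightarrow> countable P \<and> (\<forall>i\<in>P. free_arc G i) \<and>
     pairwise (\<lambda>i j. disjnt (arc_interior i) (arc_interior j)) P \<and>
     countable (G - \<Union>P)"

definition countable_Markov_partition ::
    "'a::metric_space set \<Rightarrow> ('a \<Rightarrow> 'a) \<Rightarrow> 'a set set \<Rightarrow> bool" where
  "countable_Markov_partition G g P \<longleftrightarrow> tame_partition G P \<and>
     (\<forall>i\<in>P. \<exists>h. homeomorphism i (g ` i) g h) \<and>
     (\<forall>i\<in>P. \<forall>j\<in>P. g ` i \<inter> arc_interior j \<noteq> {} \<longrightarrow> j \<subseteq> g ` i)"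

text \<open>
  Rows and columns are indexed by the arcs of a Markov partition themselves; for such
  arcs the second case is exactly \<^term>\<open>g ` i \<inter> arc_interior j = {}\<close>.
\<close>

definition transition_matrix :: "('a \<Rightarrow> 'a) \<Rightarrow> 'a set \<Rightarrow> 'a set \<Rightarrow> nat" where
  "transition_matrix g i j = (if j \<subseteq> g ` i then 1 else 0)"

definition mixing_on :: "'a::metric_space set \<Rightarrow> ('a \<Rightarrow> 'a) \<Rightarrow> bool" where
  "mixing_on G g \<longleftrightarrow> (\<forall>U V. openin (top_of_set G) U \<and> U \<noteq> {} \<and> openin (top_of_set G) V \<and> V \<noteq> {} \<longrightarrow>
     (\<exists>N. \<forall>n\<ge>N. (g ^^ n) ` U \<inter> V \<noteq> {}))"

definition Markov_shift :: "'i set \<Rightarrow> ('i \<Rightarrow> 'i \<Rightarrow> nat) \<Rightarrow> (nat \<Rightarrow> 'i) set" where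
  "Markov_shift I M = {s. (\<forall>n. s n \<in> I) \<and> (\<forall>n. M (s n) (s (Suc n)) = 1)}"

definition cylinder :: "'i set \<Rightarrow> ('i \<Rightarrow> 'i \<Rightarrow> nat) \<Rightarrow> 'i list \<Rightarrow> (nat \<Rightarrow> 'i) set" where
  "cylinder I M w = {s \<in> Markov_shift I M. \<forall>k<length w. s k = w ! k}"

definition Markov_shift_topology :: "'i set \<Rightarrow> ('i \<Rightarrow> 'i \<Rightarrow> nat) \<Rightarrow> (nat \<Rightarrow> 'i) topology" where
  "Markov_shift_topology I M = topology_generated_by (range (cylinder I M))"

lemma topspace_Markov_shift_topology [simp]:
  "topspace (Markov_shift_topology I M) = Markov_shift I M"
proof -
  have "cylinder I M [] = Markov_shift I M"
    by (simp add: cylinder_def)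
  moreover have "cylinder I M w \<subseteq> Markov_shift I M" for w
    by (auto simp: cylinder_def)
  ultimately show ?thesis
    unfolding Markov_shift_topology_def topology_generated_by_topspace by blast
qed

definition left_shift :: "(nat \<Rightarrow> 'i) \<Rightarrow> (nat \<Rightarrow> 'i)" where
  "left_shift s = (\<lambda>n. s (Suc n))"

definition borel_of :: "'a topology \<Rightarrow> 'a measure" where
  "borel_of X = sigma (topspace X) {U. openin X U}"

definition totally_invariant :: "'a set \<Rightarrow> ('a \<Rightarrow> 'a) \<Rightarrow> 'a set \<Rightarrow> bool" where
  "totally_invariant X f B \<longleftrightarrow> B \<subseteq> X \<and> {x \<in> X. f x \<in> B} = B"

definition isomorphic_mod_countable ::
    "'a topology \<Rightarrow> ('a \<Rightarrow> 'a) \<Rightarrow> 'b topology \<Rightarrow> ('b \<Rightarrow> 'b) \<Rightarrow> bool" where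
  "isomorphic_mod_countable X1 f1 X2 f2 \<longleftrightarrow>
     (\<exists>N1 N2 \<psi>.
        countable N1 \<and> totally_invariant (topspace X1) f1 N1 \<and>
        countable N2 \<and> totally_invariant (topspace X2) f2 N2 \<and>
        bij_betw \<psi> (topspace X1 - N1) (topspace X2 - N2) \<and>
        \<psi> \<in> measurable (borel_of (subtopology X1 (topspace X1 - N1)))
                        (borel_of (subtopology X2 (topspace X2 - N2))) \<and>
        the_inv_into (topspace X1 - N1) \<psi> \<in>
            measurable (borel_of (subtopology X2 (topspace X2 - N2)))
                       (borel_of (subtopology X1 (topspace X1 - N1))) \<and>
        (\<forall>x \<in> topspace X1 - N1. f2 (\<psi> x) = \<psi> (f1 x)))"

end

theory Submission imports Defs begin

text \<open>
  A point is coded by the arcs that its orbit visits. Away from a countable set every iterate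
  lies in the interior of exactly one arc, and the resulting itinerary is a point of the shift
  space by the Markov property. The proof shows that this coding is a homeomorphism once
  countable totally invariant sets are removed on both sides; it is in particular bimeasurable
  for the Borel sets.

  For the inverse, let \<open>s\<close> be a point of the shift space. The points that follow \<open>s\<close> for
  \<open>n\<close> steps form a nonempty connected compact subset of \<open>s 0\<close>, because each arc is covered by the
  image of its predecessor, on which \<open>g\<close> is invertible. So the points that follow \<open>s\<close> forever form
  a nonempty connected set. It is here that mixing enters: if this set had
  two points, it would contain two disjoint open subarcs whose images under a large iterate both
  stretch over the middle of \<open>s 0\<close>, although all iterates of \<open>g\<close> are injective on it
  (\<open>followers_unique\<close>). Hence \<open>s\<close> codes one point, which depends continuously
  on \<open>s\<close> by compactness (\<open>itinerary_set_small\<close>).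

  What must be discarded in \<open>G\<close> is a totally invariant set containing all points outside the
  arc interiors. These points are countably many, and preimages of countable sets are countable,
  since \<open>g\<close> is injective on each of countably many arcs that cover all but countably many points;
  so there is a countable set of this kind (\<open>totally_invariant_hull\<close>). On the symbolic side the
  set of all codes of its points is discarded, which is countable because each point has countably
  many codes (\<open>countable_fibre\<close>). That is not obvious, as a point may lie on infinitely many
  arcs. But as soon as an orbit hits an end of the arc prescribed by the code, all later symbols
  are forced (\<open>next_arc_at_endpoint\<close>), and before that time each symbol is determined by the point.
\<close>

section \<open>Arcs\<close>

lemma openin_arc_image:
  fixes \<gamma> :: "real \<Rightarrow> 'a::metric_space"
  assumes "arc \<gamma>" "openin (top_of_set {0..1}) T"
  shows "openin (top_of_set (path_image \<gamma>)) (\<gamma> ` T)"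
proof -
  obtain h where h: "homeomorphism {0..1} (path_image \<gamma>) \<gamma> h"
    using assms(1) by (rule homeomorphism_arc)
  show ?thesis
    using homeomorphism_imp_open_map[OF h assms(2)] .
qed

lemma connected_arc_preimage:
  fixes \<gamma> :: "real \<Rightarrow> 'a::metric_space"
  assumes "arc \<gamma>" "connected S" "S \<subseteq> path_image \<gamma>"
  shows "connected {t \<in> {0..1}. \<gamma> t \<in> S}"
proof -
  obtain h where h: "homeomorphism {0..1} (path_image \<gamma>) \<gamma> h"
    using assms(1) by (rule homeomorphism_arc)
  have "{t \<in> {0..1}. \<gamma> t \<in> S} = h ` S"
  proof (intro equalityI subsetI)
    fix t assume "t \<in> {t \<in> {0..1}. \<gamma> t \<in> S}"
    then show "t \<in> h ` S"
      using homeomorphism_apply1[OF h, of t] by (intro image_eqI[of _ _ "\<gamma> t"]) auto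
  next
    fix t assume "t \<in> h ` S"
    then obtain x where x: "x \<in> S" "t = h x" by blast
    then have "x \<in> path_image \<gamma>" using assms(3) by blast
    then show "t \<in> {t \<in> {0..1}. \<gamma> t \<in> S}"
      using x homeomorphism_apply2[OF h] homeomorphism_image2[OF h] by (metis (mono_tags, lifting) image_eqI mem_Collect_eq)
  qed
  moreover have "connected (h ` S)"
    using h assms(2,3) by (meson connected_continuous_image continuous_on_subset homeomorphism_def)
  ultimately show ?thesis by simp
qed

lemma arc_between:
  fixes \<gamma> :: "real \<Rightarrow> 'a::metric_space"
  assumes "arc \<gamma>" "connected S" "S \<subseteq> path_image \<gamma>" "\<gamma> u \<in> S" "\<gamma> v \<in> S"
    and "0 \<le> u" "u \<le> w" "w \<le> v" "v \<le> 1"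
  shows "\<gamma> w \<in> S"
proof -
  have "u \<in> {t \<in> {0..1}. \<gamma> t \<in> S}" "v \<in> {t \<in> {0..1}. \<gamma> t \<in> S}"
    using assms(4-) by auto
  then have "w \<in> {t \<in> {0..1}. \<gamma> t \<in> S}"
    using connectedD_interval[OF connected_arc_preimage[OF assms(1-3)]] assms(7,8) by blast
  then show ?thesis by simp
qed

lemma compact_arc_preimage:
  fixes \<gamma> :: "real \<Rightarrow> 'a::metric_space"
  assumes "arc \<gamma>" "compact S"
  shows "compact {t \<in> {0..1}. \<gamma> t \<in> S}"
proof -
  have "continuous_on {0..1} \<gamma>" using assms by (auto simp: arc_def path_def)
  then have "closed ({0..1} \<inter> \<gamma> -` S)"
    using continuous_closed_preimage compact_imp_closed[OF assms(2)] by blast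
  moreover have "bounded ({0..1} \<inter> \<gamma> -` S)"
    by (rule bounded_subset[OF bounded_closed_interval[of 0 1]]) auto
  moreover have "{0..1} \<inter> \<gamma> -` S = {t \<in> {0..1}. \<gamma> t \<in> S}" by auto
  ultimately show ?thesis by (simp add: compact_eq_bounded_closed)
qed

text \<open>
  Nested intersections of compact connected sets are treated inside an arc, where they can be
  transported to the unit interval and the theorems on Euclidean spaces apply.
\<close>

lemma nested_compact_in_arc:
  fixes \<gamma> :: "real \<Rightarrow> 'a::metric_space" and S :: "nat \<Rightarrow> 'a set"
  assumes "arc \<gamma>" "\<And>n. compact (S n)" "\<And>n. S n \<subseteq> path_image \<gamma>" "\<And>m n. m \<le> n \<Longrightarrow> S n \<subseteq> S m"
  shows "(\<And>n. S n \<noteq> {}) \<Longrightarrow> (\<Inter>n. S n) \<noteq> {}"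
    and "(\<And>n. connected (S n)) \<Longrightarrow> connected (\<Inter>n. S n)"
proof -
  define T where "T n = {t \<in> {0..1}. \<gamma> t \<in> S n}" for n
  have comp: "compact (T n)" for n
    unfolding T_def by (rule compact_arc_preimage[OF assms(1,2)])
  have dec: "T n \<subseteq> T m" if "m \<le> n" for m n
    using assms(4)[OF that] by (auto simp: T_def)
  have ST: "S n = \<gamma> ` T n" for n
    using assms(3)[of n] by (auto simp: T_def path_image_def)
  have inter: "(\<Inter>n. S n) = \<gamma> ` (\<Inter>n. T n)"
  proof
    show "(\<Inter>n. S n) \<subseteq> \<gamma> ` (\<Inter>n. T n)"
      using assms(3)[of 0] by (force simp: T_def path_image_def)
  qed (auto simp: T_def)
  { assume "\<And>n. S n \<noteq> {}"
    then have "T n \<noteq> {}" for n using ST by auto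
    then have "(\<Inter>n. T n) \<noteq> {}" using compact_nest[of T] comp dec by blast
    then show "(\<Inter>n. S n) \<noteq> {}" using inter by simp }
  { assume "\<And>n. connected (S n)"
    then have "connected (T n)" for n
      unfolding T_def by (rule connected_arc_preimage[OF assms(1) _ assms(3)])
    then have "connected (\<Inter>n. T n)" using connected_nest[of T] comp dec by blast
    moreover have "continuous_on (\<Inter>n. T n) \<gamma>"
      using assms(1) by (auto simp: arc_def path_def T_def intro: continuous_on_subset)
    ultimately show "connected (\<Inter>n. S n)"
      unfolding inter by (intro connected_continuous_image) }
qed

text \<open>
  The neighbourhoods with one boundary point are the initial pieces \<open>\<gamma> ` {0..<t}\<close>, whose boundary
  in the arc is \<open>{\<gamma> t}\<close>.
\<close>

lemma pathstart_in_endpoints: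
  assumes "arc \<gamma>"
  shows "pathstart \<gamma> \<in> endpoints (path_image \<gamma>)"
  unfolding endpoints_def
proof (intro CollectI conjI allI impI)
  show "pathstart \<gamma> \<in> path_image \<gamma>" by (rule pathstart_in_path_image)
next
  fix e :: real assume "e > 0"
  let ?A = "path_image \<gamma>"
  have inj: "inj_on \<gamma> {0..1}" and cont: "continuous_on {0..1} \<gamma>"
    using assms by (auto simp: arc_def path_def)
  have "\<exists>d>0. \<forall>x'\<in>{0..1}. dist x' 0 < d \<longrightarrow> dist (\<gamma> x') (\<gamma> 0) < e"
    using cont \<open>e > 0\<close> unfolding continuous_on_iff by force
  then obtain d where d: "d > 0" "\<And>x. x \<in> {0..1} \<Longrightarrow> dist x 0 < d \<Longrightarrow> dist (\<gamma> x) (\<gamma> 0) < e"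
    by blast
  define t where "t = min (d/2) (1/2)"
  have t: "0 < t" "t < d" "t < 1" using \<open>d > 0\<close> by (auto simp: t_def min_def)
  let ?V = "\<gamma> ` {0..<t}"
  have "{0..<t} = {0..1} \<inter> {..<t}" using t by auto
  then have op: "openin (top_of_set ?A) ?V"
    by (intro openin_arc_image assms) (metis open_lessThan openin_open)
  have VA: "?V \<subseteq> ?A" unfolding path_image_def using t by auto
  have cl: "top_of_set ?A closure_of ?V = \<gamma> ` {0..t}"
  proof
    have "closed (\<gamma> ` {0..t})"
      using t by (intro compact_imp_closed compact_continuous_image
          continuous_on_subset[OF cont]) auto
    then have "closedin (top_of_set ?A) (\<gamma> ` {0..t})"
      by (rule closed_subset[rotated]) (use t in \<open>auto simp: path_image_def\<close>)
    then show "top_of_set ?A closure_of ?V \<subseteq> \<gamma> ` {0..t}"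
      by (intro closure_of_minimal) auto
    have "\<gamma> ` closure {0..<t} \<subseteq> closure ?V"
      using t by (intro image_closure_subset continuous_on_subset[OF cont] closure_subset)
        auto
    then show "\<gamma> ` {0..t} \<subseteq> top_of_set ?A closure_of ?V"
      using t VA by (auto simp: closure_of_subtopology path_image_def Int_absorb1)
  qed
  have "top_of_set ?A frontier_of ?V = \<gamma> ` {0..t} - ?V"
    using cl interior_of_openin[OF op] by (simp add: frontier_of_def)
  also have "\<dots> = \<gamma> ` ({0..t} - {0..<t})"
    using t by (intro inj_on_image_set_diff[OF inj, symmetric]) auto
  also have "{0..t} - {0..<t} = {t}" using t by auto
  finally have fr: "card (top_of_set ?A frontier_of ?V) = 1" by simp
  have "nbhd_in ?A (pathstart \<gamma>) ?V"
    using op VA t by (auto simp: nbhd_in_def interior_of_openin pathstart_def)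
  moreover have "?V \<subseteq> ball (pathstart \<gamma>) e"
    using d(2) t by (auto simp: pathstart_def dist_commute dist_real_def)
  ultimately show "\<exists>V. nbhd_in ?A (pathstart \<gamma>) V \<and> V \<subseteq> ball (pathstart \<gamma>) e \<and>
      card (top_of_set ?A frontier_of V) = 1"
    using fr by blast
qed

text \<open>
  A neighbourhood of an inner point \<open>\<gamma> t\<close> that avoids both ends must be left when moving from
  \<open>t\<close> to \<open>0\<close> and also when moving from \<open>t\<close> to \<open>1\<close>, so it has a boundary point on either side.
\<close>

lemma endpoints_path_image:
  assumes "arc \<gamma>"
  shows "endpoints (path_image \<gamma>) = {pathstart \<gamma>, pathfinish \<gamma>}"
proof
  show "{pathstart \<gamma>, pathfinish \<gamma>} \<subseteq> endpoints (path_image \<gamma>)"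
    using pathstart_in_endpoints[OF assms] pathstart_in_endpoints[of "reversepath \<gamma>"] assms
    by (simp add: arc_reversepath)
next
  let ?A = "path_image \<gamma>"
  have inj: "inj_on \<gamma> {0..1}" and cont: "continuous_on {0..1} \<gamma>"
    using assms by (auto simp: arc_def path_def)
  show "endpoints ?A \<subseteq> {pathstart \<gamma>, pathfinish \<gamma>}"
  proof (rule subsetI, rule ccontr)
    fix x assume x: "x \<in> endpoints ?A" and "x \<notin> {pathstart \<gamma>, pathfinish \<gamma>}"
    then have ne: "x \<noteq> \<gamma> 0" "x \<noteq> \<gamma> 1" by (auto simp: pathstart_def pathfinish_def)
    have "x \<in> ?A" using x by (simp add: endpoints_def)
    then obtain t where t: "x = \<gamma> t" "0 \<le> t" "t \<le> 1"
      by (auto simp: path_image_def)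
    define e where "e = min (dist x (\<gamma> 0)) (dist x (\<gamma> 1))"
    have "e > 0" using ne by (simp add: e_def)
    then obtain V where V: "nbhd_in ?A x V" "V \<subseteq> ball x e"
        "card (top_of_set ?A frontier_of V) = 1"
      using x unfolding endpoints_def by blast
    obtain z where z: "top_of_set ?A frontier_of V = {z}"
      using V(3) by (rule card_1_singletonE)
    have xI: "x \<in> top_of_set ?A interior_of V" using V(1) by (simp add: nbhd_in_def)
    then have xV: "x \<in> V" using interior_of_subset by fastforce
    have out: "\<gamma> 0 \<notin> V" "\<gamma> 1 \<notin> V" using V(2) by (auto simp: e_def)
    have cross: "z \<in> \<gamma> ` T" if "connected T" "T \<subseteq> {0..1}" "t \<in> T" "0 \<in> T \<or> 1 \<in> T" for T
    proof -
      have "connected (\<gamma> ` T)"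
        using that by (intro connected_continuous_image continuous_on_subset[OF cont])
      then have "connectedin (top_of_set ?A) (\<gamma> ` T)"
        using that(2) by (auto simp: connectedin_subtopology path_image_def)
      moreover have "\<gamma> ` T \<inter> V \<noteq> {}" "\<gamma> ` T - V \<noteq> {}"
        using that xV t out by auto
      ultimately have "\<gamma> ` T \<inter> top_of_set ?A frontier_of V \<noteq> {}"
        by (rule connectedin_Int_frontier_of)
      then show ?thesis using z by simp
    qed
    have "z \<in> \<gamma> ` {0..t}" "z \<in> \<gamma> ` {t..1}"
      using t by (auto intro!: cross)
    then obtain a b where ab: "a \<in> {0..t}" "z = \<gamma> a" "b \<in> {t..1}" "z = \<gamma> b" by blast
    then have "a = b" using inj t by (auto simp: inj_on_def)
    then have "z = x" using ab t by simp
    then show False using z xI by (auto simp: frontier_of_def)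
  qed
qed

lemma arc_interior_path_image:
  assumes "arc \<gamma>"
  shows "arc_interior (path_image \<gamma>) = \<gamma> ` {0<..<1}"
proof -
  have inj: "inj_on \<gamma> {0..1}" using assms by (simp add: arc_def)
  have "arc_interior (path_image \<gamma>) = \<gamma> ` {0..1} - \<gamma> ` {0,1}"
    unfolding arc_interior_def endpoints_path_image[OF assms]
    by (simp add: path_image_def pathstart_def pathfinish_def)
  also have "\<dots> = \<gamma> ` ({0..1} - {0,1})"
    by (intro inj_on_image_set_diff[OF inj, symmetric]) auto
  also have "{0..1} - {0,1::real} = {0<..<1}" by auto
  finally show ?thesis .
qed

lemma arc_subset_closure_interior:
  assumes "is_arc \<alpha>"
  shows "\<alpha> \<subseteq> closure (arc_interior \<alpha>)"
proof -
  obtain \<gamma> where \<gamma>: "arc \<gamma>" "path_image \<gamma> = \<alpha>" using assms by (auto simp: is_arc_def)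
  then have "continuous_on {0..1} \<gamma>" by (simp add: arc_def path_def)
  then have "\<gamma> ` closure {0<..<1} \<subseteq> closure (\<gamma> ` {0<..<1})"
    by (intro image_closure_subset closure_subset) auto
  then show ?thesis using arc_interior_path_image[OF \<gamma>(1)] \<gamma>(2) by (auto simp: path_image_def)
qed

lemma is_arc_image:
  assumes "is_arc \<alpha>" "continuous_on \<alpha> f" "inj_on f \<alpha>"
  shows "is_arc (f ` \<alpha>)" and "endpoints (f ` \<alpha>) = f ` endpoints \<alpha>"
proof -
  obtain \<gamma> where \<gamma>: "arc \<gamma>" "path_image \<gamma> = \<alpha>" using assms(1) by (auto simp: is_arc_def)
  have f\<gamma>: "arc (f \<circ> \<gamma>)" "path_image (f \<circ> \<gamma>) = f ` \<alpha>"
    using \<gamma> assms(2,3)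
    by (auto simp: arc_def path_image_compose intro!: path_continuous_image comp_inj_on)
       (simp add: path_image_def)
  then show "is_arc (f ` \<alpha>)" by (auto simp: is_arc_def)
  show "endpoints (f ` \<alpha>) = f ` endpoints \<alpha>"
    using endpoints_path_image[OF \<gamma>(1)] endpoints_path_image[OF f\<gamma>(1)] \<gamma>(2) f\<gamma>(2)
    by (simp add: pathstart_compose pathfinish_compose)
qed

lemma arc_from_endpoint:
  assumes "is_arc \<alpha>" "x \<in> endpoints \<alpha>"
  obtains \<gamma> where "arc \<gamma>" "path_image \<gamma> = \<alpha>" "\<gamma> 0 = x"
proof -
  obtain \<gamma> where \<gamma>: "arc \<gamma>" "path_image \<gamma> = \<alpha>" using assms(1) by (auto simp: is_arc_def)
  then have "pathstart \<gamma> = x \<or> pathstart (reversepath \<gamma>) = x"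
    using endpoints_path_image[OF \<gamma>(1)] assms(2) by auto
  then show thesis
    using that[of \<gamma>] that[of "reversepath \<gamma>"] \<gamma>
    by (auto simp: pathstart_def arc_reversepath)
qed

text \<open>
  A subarc that contains one end of an arc is an initial piece of it. Consequently two such subarcs
  have overlapping interiors, which is how this lemma is used.
\<close>

lemma subarc_at_start:
  assumes "arc \<gamma>" "is_arc \<beta>" "\<beta> \<subseteq> path_image \<gamma>" "\<gamma> 0 \<in> \<beta>"
  obtains b where "0 < b" "b \<le> 1" "\<gamma> 0 \<in> endpoints \<beta>" "arc_interior \<beta> = \<gamma> ` {0<..<b}"
proof -
  have inj: "inj_on \<gamma> {0..1}" and cont: "continuous_on {0..1} \<gamma>"
    using assms by (auto simp: arc_def path_def)
  obtain \<delta> where \<delta>: "arc \<delta>" "path_image \<delta> = \<beta>" using assms(2) by (auto simp: is_arc_def)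
  have comp: "compact \<beta>" "connected \<beta>"
    using \<delta> compact_arc_image connected_arc_image by blast+
  define T where "T = {t \<in> {0..1}. \<gamma> t \<in> \<beta>}"
  have "connected T" unfolding T_def by (rule connected_arc_preimage[OF assms(1) comp(2) assms(3)])
  moreover have "compact T" unfolding T_def by (rule compact_arc_preimage[OF assms(1) comp(1)])
  ultimately obtain a b where ab: "T = {a..b}" using connected_compact_interval_1 by blast
  have "0 \<in> T" using assms(4) by (simp add: T_def)
  then have "a \<le> 0" "0 \<le> b" using ab by auto
  then have "{a, b} \<subseteq> T" using ab by auto
  then have "0 \<le> a" "b \<le> 1" by (auto simp: T_def)
  have "\<beta> = \<gamma> ` T" using assms(3) by (auto simp: T_def path_image_def)
  then have \<beta>: "\<beta> = \<gamma> ` {0..b}" using ab \<open>a \<le> 0\<close> \<open>0 \<le> a\<close> by simp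
  have "b \<noteq> 0"
  proof
    assume "b = 0"
    then have "\<delta> 0 = \<delta> 1" using \<beta> \<delta>(2) \<open>b = 0\<close> unfolding path_image_def
      by (metis atLeastAtMost_iff atLeastAtMost_singleton image_empty image_eqI image_insert order_refl singletonD zero_le_one)
    then show False using \<delta>(1) by (force simp: arc_def inj_on_def)
  qed
  then have "0 < b" using \<open>0 \<le> b\<close> by simp
  define \<eta> where "\<eta> = \<gamma> \<circ> (*) b"
  have unit: "(*) b ` {0..1} = {0..b}"
    using image_mult_atLeastAtMost[of b 0 1] \<open>0 < b\<close> by simp
  have "continuous_on ((*) b ` {0..1}) \<gamma>" "inj_on \<gamma> ((*) b ` {0..1})"
    unfolding unit using \<open>b \<le> 1\<close>
    by (intro continuous_on_subset[OF cont] inj_on_subset[OF inj]; simp)+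
  moreover have "continuous_on {0..1} ((*) b)" "inj_on ((*) b) {0..1}"
    using \<open>0 < b\<close> by (auto intro!: continuous_intros simp: inj_on_def)
  ultimately have "continuous_on {0..1} \<eta>" "inj_on \<eta> {0..1}"
    unfolding \<eta>_def by (blast intro: continuous_on_compose comp_inj_on)+
  then have "arc \<eta>" by (simp add: arc_def path_def)
  moreover have "path_image \<eta> = \<beta>" using \<beta> unit by (simp add: \<eta>_def path_image_compose) (simp add: path_image_def)
  ultimately have "endpoints \<beta> = {pathstart \<eta>, pathfinish \<eta>}" "arc_interior \<beta> = \<eta> ` {0<..<1}"
    using endpoints_path_image arc_interior_path_image by metis+
  moreover have "pathstart \<eta> = \<gamma> 0" by (simp add: \<eta>_def pathstart_def)
  moreover have "\<eta> ` {0<..<1} = \<gamma> ` ((*) b ` {0<..<1})"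
    by (simp add: \<eta>_def image_image)
  moreover have "(*) b ` {0<..<1} = {0<..<b}"
    using \<open>0 < b\<close> by (auto simp: field_simps intro!: image_eqI[of _ _ "_ / b"])
  ultimately show thesis using that[of b] \<open>0 < b\<close> \<open>b \<le> 1\<close> by simp
qed


section \<open>Isomorphism modulo countable invariant sets\<close>

text \<open>
  The grand orbit of \<open>A\<close>, i.e. the set of points some iterate of which meets the forward orbit of a
  point of \<open>A\<close>, is totally invariant, and it arises from \<open>A\<close> by countably many images and preimages.
\<close>

lemma totally_invariant_hull:
  assumes "f \<in> X \<rightarrow> X" "A \<subseteq> X" "countable A"
    and preimage: "\<And>B. countable B \<Longrightarrow> countable {x \<in> X. f x \<in> B}"
  obtains N where "A \<subseteq> N" "countable N" "totally_invariant X f N"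
proof -
  define N where "N = (\<Union>n m. {x \<in> X. (f ^^ n) x \<in> (f ^^ m) ` A})"
  have "countable {x \<in> X. (f ^^ n) x \<in> B}" if "countable B" for n B
    using that
  proof (induction n arbitrary: B)
    case 0
    have "{x \<in> X. (f ^^ 0) x \<in> B} \<subseteq> B" by auto
    then show ?case using 0 countable_subset by blast
  next
    case (Suc n)
    have "{x \<in> X. (f ^^ Suc n) x \<in> B} = {x \<in> X. f x \<in> {y \<in> X. (f ^^ n) y \<in> B}}"
      using assms(1) by (auto simp: funpow_swap1)
    then show ?case using preimage[OF Suc.IH[OF Suc.prems]] by simp
  qed
  then have "countable N"
    unfolding N_def using assms(3) by (intro countable_UN countable_image) auto
  moreover have "A \<subseteq> N"
  proof
    fix x assume "x \<in> A"
    then have "x \<in> {x \<in> X. (f ^^ 0) x \<in> (f ^^ 0) ` A}" using assms(2) by auto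
    then show "x \<in> N" unfolding N_def by blast
  qed
  moreover have "f x \<in> N \<longleftrightarrow> x \<in> N" if "x \<in> X" for x
  proof
    assume "f x \<in> N"
    then obtain n m where "(f ^^ n) (f x) \<in> (f ^^ m) ` A" by (auto simp: N_def)
    then have "x \<in> {x \<in> X. (f ^^ Suc n) x \<in> (f ^^ m) ` A}" using that by (simp add: funpow_swap1)
    then show "x \<in> N" unfolding N_def by blast
  next
    assume "x \<in> N"
    then obtain n m a where "(f ^^ n) x = (f ^^ m) a" "a \<in> A" by (auto simp: N_def)
    then have "(f ^^ n) (f x) = (f ^^ Suc m) a" "a \<in> A" by (simp_all add: funpow_swap1[symmetric])
    then have "f x \<in> {x \<in> X. (f ^^ n) x \<in> (f ^^ Suc m) ` A}" using that assms(1) by blast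
    then show "f x \<in> N" unfolding N_def by blast
  qed
  moreover have "N \<subseteq> X" by (auto simp: N_def)
  ultimately show thesis using that unfolding totally_invariant_def by blast
qed

lemma continuous_map_borel_of:
  assumes "continuous_map X Y f"
  shows "f \<in> measurable (borel_of X) (borel_of Y)"
proof -
  have sub: "{U. openin Z U} \<subseteq> Pow (topspace Z)" for Z :: "'c topology"
    using openin_subset by blast
  have space: "space (borel_of X) = topspace X"
    unfolding borel_of_def by (rule space_measure_of[OF sub])
  show ?thesis
    unfolding borel_of_def[of Y]
  proof (rule measurable_measure_of)
    show "{U. openin Y U} \<subseteq> Pow (topspace Y)" using openin_subset by blast
    show "f \<in> space (borel_of X) \<rightarrow> topspace Y"
      using assms space by (auto simp: continuous_map_def)
    fix U assume "U \<in> {U. openin Y U}"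
    then have "openin X {x \<in> topspace X. f x \<in> U}" using assms by (simp add: continuous_map_def)
    moreover have "f -` U \<inter> space (borel_of X) = {x \<in> topspace X. f x \<in> U}" using space by auto
    moreover have "sets (borel_of X) = sigma_sets (topspace X) {U. openin X U}"
      unfolding borel_of_def by (rule sets_measure_of) (use openin_subset in blast)
    ultimately show "f -` U \<inter> space (borel_of X) \<in> sets (borel_of X)" by auto
  qed
qed

lemma isomorphic_mod_countableI:
  fixes X1 :: "'a topology" and X2 :: "'b topology"
  defines "Y1 \<equiv> \<lambda>N. subtopology X1 (topspace X1 - N)" and "Y2 \<equiv> \<lambda>N. subtopology X2 (topspace X2 - N)"
  assumes "countable N1" "totally_invariant (topspace X1) f1 N1"
    and "countable N2" "totally_invariant (topspace X2) f2 N2"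
    and hom: "homeomorphic_maps (Y1 N1) (Y2 N2) \<psi> \<phi>"
    and "\<And>x. x \<in> topspace X1 - N1 \<Longrightarrow> f2 (\<psi> x) = \<psi> (f1 x)"
  shows "isomorphic_mod_countable X1 f1 X2 f2"
proof -
  let ?D1 = "topspace X1 - N1" and ?D2 = "topspace X2 - N2"
  have top: "topspace (Y1 N1) = ?D1" "topspace (Y2 N2) = ?D2"
    by (auto simp: Y1_def Y2_def)
  have cont: "continuous_map (Y1 N1) (Y2 N2) \<psi>" "continuous_map (Y2 N2) (Y1 N1) \<phi>"
    and inv: "\<And>x. x \<in> ?D1 \<Longrightarrow> \<phi> (\<psi> x) = x" "\<And>y. y \<in> ?D2 \<Longrightarrow> \<psi> (\<phi> y) = y"
    using hom top by (auto simp: homeomorphic_maps_def)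
  have maps: "\<psi> ` ?D1 \<subseteq> ?D2" "\<phi> ` ?D2 \<subseteq> ?D1"
    using cont[THEN continuous_map_image_subset_topspace] top by auto
  have bij: "bij_betw \<psi> ?D1 ?D2"
    using inv maps by (intro bij_betw_byWitness[where f' = \<phi>]) auto
  have "the_inv_into ?D1 \<psi> y = \<phi> y" if "y \<in> ?D2" for y
    using that bij inv maps by (intro the_inv_into_f_eq) (auto simp: bij_betw_def)
  then have "continuous_map (Y2 N2) (Y1 N1) (the_inv_into ?D1 \<psi>)"
    using cont(2) top(2) by (auto intro: continuous_map_eq)
  then show ?thesis
    unfolding isomorphic_mod_countable_def
    using assms(3-6,8) bij cont(1) by (auto simp: Y1_def Y2_def intro!: exI[of _ N1] exI[of _ N2] exI[of _ \<psi>] continuous_map_borel_of)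
qed


section \<open>Arcs of a Markov partition\<close>

locale mixing_Markov_map =
  fixes G :: "'a::metric_space set" and g :: "'a \<Rightarrow> 'a" and P :: "'a set set"
  assumes continuous: "continuous_on G g" and maps: "g \<in> G \<rightarrow> G"
    and mixing: "mixing_on G g" and Markov: "countable_Markov_partition G g P"
begin

abbreviation "shift_space \<equiv> Markov_shift P (transition_matrix g)"

lemma partition: "tame_partition G P"
  using Markov by (simp add: countable_Markov_partition_def)

lemma countable_partition: "countable P"
  using partition by (simp add: tame_partition_def)

lemma
  assumes "i \<in> P"
  shows arc: "is_arc i" and subset: "i \<subseteq> G" and open_interior: "openin (top_of_set G) (arc_interior i)"
  using partition assms by (auto simp: tame_partition_def free_arc_def)

lemma partition_homeomorphism:
  assumes "i \<in> P"
  obtains h where "homeomorphism i (g ` i) g h"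
  using Markov assms by (auto simp: countable_Markov_partition_def)

lemma inj_on_arc: "i \<in> P \<Longrightarrow> inj_on g i"
  by (metis (no_types) homeomorphism_apply1 inj_on_inverseI partition_homeomorphism)

lemma image_covers:
  assumes "i \<in> P" "j \<in> P" "x \<in> i" "g x \<in> arc_interior j"
  shows "j \<subseteq> g ` i"
  using Markov assms unfolding countable_Markov_partition_def by blast

text \<open>
  The interiors are disjoint by assumption. Since the interior of \<open>j\<close> is open in \<open>G\<close> and \<open>i\<close> lies in
  the closure of its own interior, no end of \<open>i\<close> can be in the interior of another arc either.
\<close>

lemma meets_interior:
  assumes "i \<in> P" "j \<in> P" "x \<in> i" "x \<in> arc_interior j"
  shows "i = j"
proof -
  obtain W where W: "open W" "arc_interior j = G \<inter> W"
    using open_interior[OF assms(2)] by (auto simp: openin_open)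
  have "x \<in> W \<inter> closure (arc_interior i)"
    using arc_subset_closure_interior[OF arc[OF assms(1)]] assms(3,4) W(2) by blast
  then have "W \<inter> arc_interior i \<noteq> {}"
    using open_Int_closure_eq_empty[OF W(1)] by blast
  then have "\<not> disjnt (arc_interior i) (arc_interior j)"
    using W(2) subset[OF assms(1)] by (auto simp: arc_interior_def disjnt_def)
  then show ?thesis
    using partition assms(1,2) by (auto simp: tame_partition_def pairwise_def)
qed

lemma in_shift_space:
  "s \<in> shift_space \<longleftrightarrow> (\<forall>n. s n \<in> P) \<and> (\<forall>n. s (Suc n) \<subseteq> g ` s n)"
  by (auto simp: Markov_shift_def transition_matrix_def)

lemma left_shift_in_shift_space: "s \<in> shift_space \<Longrightarrow> left_shift s \<in> shift_space"
  by (simp add: in_shift_space left_shift_def)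

lemma funpow_in: "x \<in> G \<Longrightarrow> (g ^^ n) x \<in> G"
  using maps by (induction n) auto

lemma continuous_funpow: "continuous_on G (g ^^ n)"
proof (induction n)
  case (Suc n)
  have "continuous_on ((g ^^ n) ` G) g"
    by (rule continuous_on_subset[OF continuous]) (use funpow_in in blast)
  then show ?case using continuous_on_compose[OF Suc] by simp
qed (simp add: id_def)

section \<open>Points that follow a given code\<close>

definition itinerary_set :: "(nat \<Rightarrow> 'a set) \<Rightarrow> nat \<Rightarrow> 'a set" where
  "itinerary_set s n = {x. \<forall>k\<le>n. (g ^^ k) x \<in> s k}"

lemma itinerary_set_subset: "itinerary_set s n \<subseteq> s 0"
  by (auto simp: itinerary_set_def)

lemma itinerary_set_antimono: "m \<le> n \<Longrightarrow> itinerary_set s n \<subseteq> itinerary_set s m"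
  by (auto simp: itinerary_set_def)

text \<open>
  Peeling off the first symbol instead of the last one exhibits each such set as a continuous image
  of a shorter one, which gives compactness and connectedness by induction over all codes.
\<close>

lemma itinerary_set_Suc:
  assumes s: "s \<in> shift_space" and h: "homeomorphism (s 0) (g ` s 0) g h"
  shows "itinerary_set s (Suc n) = h ` itinerary_set (left_shift s) n"
proof (intro equalityI subsetI)
  fix x assume x: "x \<in> itinerary_set s (Suc n)"
  then have "x \<in> s 0" using itinerary_set_subset by blast
  then have "h (g x) = x" using homeomorphism_apply1[OF h] by simp
  moreover have "(g ^^ k) (g x) \<in> s (Suc k)" if "k \<le> n" for k
    using x that by (auto simp: itinerary_set_def funpow_swap1[symmetric] dest: spec[of _ "Suc k"])
  ultimately show "x \<in> h ` itinerary_set (left_shift s) n"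
    by (intro image_eqI[of _ _ "g x"]) (auto simp: itinerary_set_def left_shift_def)
next
  fix x assume "x \<in> h ` itinerary_set (left_shift s) n"
  then obtain y where y: "x = h y" "y \<in> itinerary_set (left_shift s) n" by blast
  then have "y \<in> s 1" using itinerary_set_subset[of "left_shift s"] by (auto simp: left_shift_def)
  then have "y \<in> g ` s 0" using s by (auto simp: in_shift_space)
  then have "x \<in> s 0" "g x = y"
    using y(1) homeomorphism_apply2[OF h] homeomorphism_image2[OF h] by auto
  show "x \<in> itinerary_set s (Suc n)"
    unfolding itinerary_set_def
  proof (intro CollectI allI impI)
    fix k assume "k \<le> Suc n"
    then show "(g ^^ k) x \<in> s k"
      using \<open>x \<in> s 0\<close> \<open>g x = y\<close> y(2)
      by (cases k) (auto simp: itinerary_set_def left_shift_def funpow_swap1)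
  qed
qed

lemma itinerary_set_continuum:
  assumes "s \<in> shift_space"
  shows "itinerary_set s n \<noteq> {} \<and> compact (itinerary_set s n) \<and> connected (itinerary_set s n)"
  using assms
proof (induction n arbitrary: s)
  case 0
  then have "is_arc (s 0)" using arc by (simp add: in_shift_space)
  then obtain \<gamma> where "arc \<gamma>" "path_image \<gamma> = s 0" by (auto simp: is_arc_def)
  moreover have "itinerary_set s 0 = s 0" by (simp add: itinerary_set_def)
  ultimately show ?case
    using compact_arc_image connected_arc_image path_image_nonempty by metis
next
  case (Suc n)
  have "s 0 \<in> P" and next_arc: "s 1 \<subseteq> g ` s 0" using Suc.prems by (auto simp: in_shift_space)
  then obtain h where h: "homeomorphism (s 0) (g ` s 0) g h" using partition_homeomorphism by blast
  have "itinerary_set (left_shift s) n \<subseteq> g ` s 0"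
    using itinerary_set_subset[of "left_shift s" n] next_arc by (auto simp: left_shift_def)
  then have "continuous_on (itinerary_set (left_shift s) n) h"
    using h by (meson continuous_on_subset homeomorphism_cont2)
  then show ?case
    unfolding itinerary_set_Suc[OF Suc.prems h]
    using Suc.IH[OF left_shift_in_shift_space[OF Suc.prems]]
    by (simp add: compact_continuous_image connected_continuous_image)
qed

definition followers :: "(nat \<Rightarrow> 'a set) \<Rightarrow> 'a set" where
  "followers s = {x. \<forall>n. (g ^^ n) x \<in> s n}"

lemma followers_INT: "followers s = (\<Inter>n. itinerary_set s n)"
  by (auto simp: followers_def itinerary_set_def)

lemma followers_subset: "followers s \<subseteq> s 0"
  unfolding followers_INT using itinerary_set_subset by blast

lemma followers_in_G: "s \<in> shift_space \<Longrightarrow> followers s \<subseteq> G"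
  using followers_subset subset by (fastforce simp: in_shift_space)

lemma
  assumes s: "s \<in> shift_space"
  shows followers_nonempty: "followers s \<noteq> {}" and connected_followers: "connected (followers s)"
proof -
  have "is_arc (s 0)" using s arc by (simp add: in_shift_space)
  then obtain \<gamma> where \<gamma>: "arc \<gamma>" "path_image \<gamma> = s 0" by (auto simp: is_arc_def)
  note nested = nested_compact_in_arc[OF \<gamma>(1), of "itinerary_set s", unfolded \<gamma>(2)]
  show "followers s \<noteq> {}" "connected (followers s)"
    unfolding followers_INT
    by (rule nested; use itinerary_set_continuum[OF s] itinerary_set_subset itinerary_set_antimono in blast)+
qed

lemma funpow_inj_on_followers:
  assumes "s \<in> shift_space"
  shows "inj_on (g ^^ n) (followers s)"
proof (rule inj_onI)
  fix x y assume xy: "x \<in> followers s" "y \<in> followers s" "(g ^^ n) x = (g ^^ n) y"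
  from xy(3) show "x = y"
  proof (induction n)
    case (Suc n)
    have "inj_on g (s n)" using assms inj_on_arc by (simp add: in_shift_space)
    moreover have "(g ^^ n) x \<in> s n" "(g ^^ n) y \<in> s n" using xy(1,2) by (auto simp: followers_def)
    ultimately show ?case using Suc by (auto dest: inj_onD)
  qed simp
qed

lemma open_subarc:
  assumes "i \<in> P" "arc \<gamma>" "path_image \<gamma> = i" "0 \<le> u" "v \<le> 1"
  shows "openin (top_of_set G) (\<gamma> ` {u<..<v})"
proof -
  have "openin (top_of_set {0..1}) {u<..<v}"
    by (rule open_subset) (use assms(4,5) in auto)
  then have op: "openin (top_of_set i) (\<gamma> ` {u<..<v})"
    using openin_arc_image[OF assms(2)] assms(3) by blast
  have "\<gamma> ` {u<..<v} \<subseteq> arc_interior i"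
    using arc_interior_path_image[OF assms(2)] assms(3-5) by auto
  moreover have "arc_interior i \<subseteq> i" by (auto simp: arc_interior_def)
  ultimately have "openin (top_of_set (arc_interior i)) (\<gamma> ` {u<..<v})"
    using op by (rule openin_subset_trans[rotated])
  then show ?thesis using open_interior[OF assms(1)] by (rule openin_trans)
qed

lemma mixing_meets:
  assumes "openin (top_of_set G) U" "U \<noteq> {}" "openin (top_of_set G) V" "V \<noteq> {}"
  shows "\<forall>\<^sub>F n in sequentially. (g ^^ n) ` U \<inter> V \<noteq> {}"
  using mixing assms unfolding mixing_on_def eventually_sequentially by blast

text \<open>
  Two points following \<open>s\<close> are joined by a subarc \<open>\<gamma> ` {a..b}\<close> of points following \<open>s\<close>. Cut it at \<open>c\<close>.
  By mixing, high iterates of each half meet both the first and the last third of \<open>s 0\<close>. They lie in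
  \<open>s n\<close>, which is then \<open>s 0\<close> itself, so being connected both of them contain its middle point
  \<open>\<gamma> (1/2)\<close>. This contradicts the injectivity of \<open>g ^^ n\<close> on the points following \<open>s\<close>.
\<close>

lemma followers_unique:
  assumes s: "s \<in> shift_space" and "x \<in> followers s" "y \<in> followers s"
  shows "x = y"
proof (rule ccontr)
  assume "x \<noteq> y"
  have P: "s n \<in> P" for n using s by (simp add: in_shift_space)
  obtain \<gamma> where \<gamma>: "arc \<gamma>" "path_image \<gamma> = s 0"
    using arc[OF P[of 0]] by (auto simp: is_arc_def)
  have inj: "inj_on \<gamma> {0..1}" and cont: "continuous_on {0..1} \<gamma>"
    using \<gamma>(1) by (auto simp: arc_def path_def)
  have "x \<in> \<gamma> ` {0..1}" "y \<in> \<gamma> ` {0..1}"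
    using followers_subset[of s] assms(2,3) \<gamma>(2) by (auto simp: path_image_def)
  then obtain t u where tu: "t \<in> {0..1}" "x = \<gamma> t" "u \<in> {0..1}" "y = \<gamma> u" by blast
  define a b c where "a = min t u" and "b = max t u" and "c = (min t u + max t u) / 2"
  have "t \<noteq> u" using \<open>x \<noteq> y\<close> tu by blast
  then have ab: "0 \<le> a" "a < c" "c < b" "b \<le> 1" "\<gamma> a \<in> followers s" "\<gamma> b \<in> followers s"
    using tu assms(2,3) by (auto simp: a_def b_def c_def min_def max_def)
  have in_followers: "\<gamma> w \<in> followers s" if "a \<le> w" "w \<le> b" for w
    using arc_between[OF \<gamma>(1) connected_followers[OF s] _ ab(5,6,1) that ab(4)]
      followers_subset[of s] \<gamma>(2) by blast
  have op: "openin (top_of_set G) (\<gamma> ` {p<..<q})" if "0 \<le> p" "q \<le> 1" for p q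
    by (rule open_subarc[OF P \<gamma> that])
  define V1 V3 where "V1 = \<gamma> ` {0<..<1/3}" and "V3 = \<gamma> ` {2/3<..<1}"
  have V: "openin (top_of_set G) V1" "V1 \<noteq> {}" "openin (top_of_set G) V3" "V3 \<noteq> {}"
    unfolding V1_def V3_def by (auto intro!: op)
  have middle: "\<forall>\<^sub>F n in sequentially. \<gamma> (1/2) \<in> (g ^^ n) ` \<gamma> ` {p<..<q}"
    if pq: "a \<le> p" "p < q" "q \<le> b" for p q
  proof -
    let ?U = "\<gamma> ` {p<..<q}"
    have U: "openin (top_of_set G) ?U" "?U \<noteq> {}" using pq ab by (auto intro!: op)
    have UF: "?U \<subseteq> followers s" using pq in_followers by auto
    have "connected ?U"
      using pq ab by (intro connected_continuous_image continuous_on_subset[OF cont]) auto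
    from mixing_meets[OF U V(1,2)] mixing_meets[OF U V(3,4)]
    show ?thesis
    proof eventually_elim
      case (elim n)
      obtain v w where vw: "v \<in> {0<..<1/3}" "\<gamma> v \<in> (g ^^ n) ` ?U" "w \<in> {2/3<..<1}" "\<gamma> w \<in> (g ^^ n) ` ?U"
      proof -
        obtain p1 p2 where "p1 \<in> (g ^^ n) ` ?U" "p1 \<in> V1" "p2 \<in> (g ^^ n) ` ?U" "p2 \<in> V3"
          using elim by (meson IntE equals0I)
        then show thesis using that unfolding V1_def V3_def by (metis imageE)
      qed
      have "(g ^^ n) ` ?U \<subseteq> s n" using UF by (auto simp: followers_def)
      moreover have "s n = s 0"
      proof (rule meets_interior[OF P P])
        show "\<gamma> v \<in> s n" using vw(2) calculation by blast
        show "\<gamma> v \<in> arc_interior (s 0)"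
          using vw(1) arc_interior_path_image[OF \<gamma>(1)] \<gamma>(2) by auto
      qed
      ultimately have "(g ^^ n) ` ?U \<subseteq> path_image \<gamma>" using \<gamma>(2) by simp
      moreover have "continuous_on ?U (g ^^ n)"
        using UF followers_in_G[OF s] by (intro continuous_on_subset[OF continuous_funpow]) blast
      then have "connected ((g ^^ n) ` ?U)"
        using \<open>connected ?U\<close> by (rule connected_continuous_image)
      ultimately show ?case
        using arc_between[OF \<gamma>(1), of "(g ^^ n) ` ?U" v w "1/2"] vw by auto
    qed
  qed
  have "\<forall>\<^sub>F n in sequentially. \<gamma> (1/2) \<in> (g ^^ n) ` \<gamma> ` {a<..<c} \<inter> (g ^^ n) ` \<gamma> ` {c<..<b}"
    using eventually_conj[OF middle[of a c] middle[of c b]] ab by simp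
  then obtain n where "\<gamma> (1/2) \<in> (g ^^ n) ` \<gamma> ` {a<..<c} \<inter> (g ^^ n) ` \<gamma> ` {c<..<b}"
    by (metis (no_types, lifting) eventually_happens trivial_limit_sequentially)
  then obtain v w where vw: "v \<in> {a<..<c}" "w \<in> {c<..<b}" "(g ^^ n) (\<gamma> v) = (g ^^ n) (\<gamma> w)"
    by auto
  then have "\<gamma> v = \<gamma> w"
    using funpow_inj_on_followers[OF s, of n] in_followers by (auto dest!: inj_onD)
  then have "v = w" using inj vw ab by (auto dest!: inj_onD)
  then show False using vw by simp
qed

definition coded_point :: "(nat \<Rightarrow> 'a set) \<Rightarrow> 'a" where
  "coded_point s = (THE x. x \<in> followers s)"

lemma followers_eq: "s \<in> shift_space \<Longrightarrow> followers s = {coded_point s}"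
  unfolding coded_point_def
  using followers_nonempty followers_unique by (metis (no_types, lifting) equals0I insertI1 is_singletonI' is_singleton_the_elem singletonD the_equality)

lemma coded_point_eqI: "s \<in> shift_space \<Longrightarrow> x \<in> followers s \<Longrightarrow> coded_point s = x"
  using followers_eq[of s] by simp

lemma coded_point_follows: "s \<in> shift_space \<Longrightarrow> (g ^^ n) (coded_point s) \<in> s n"
  using followers_eq[of s] by (auto simp: followers_def)

lemma coded_point_in: "s \<in> shift_space \<Longrightarrow> coded_point s \<in> G"
  using followers_eq followers_in_G by blast

lemma coded_point_left_shift:
  assumes "s \<in> shift_space"
  shows "coded_point (left_shift s) = g (coded_point s)"
proof (rule coded_point_eqI[OF left_shift_in_shift_space[OF assms]])
  show "g (coded_point s) \<in> followers (left_shift s)"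
    using coded_point_follows[OF assms, of "Suc _"]
    by (simp add: followers_def left_shift_def funpow_swap1)
qed

text \<open>
  Otherwise the compact sets \<open>itinerary_set s n - U\<close> would be nonempty, hence have a common point,
  and this point would follow \<open>s\<close> while being different from the coded point.
\<close>

lemma itinerary_set_small:
  assumes s: "s \<in> shift_space" and "open U" "coded_point s \<in> U"
  obtains n where "itinerary_set s n \<subseteq> U"
proof (rule ccontr)
  assume "\<not> thesis"
  then have ne: "itinerary_set s n - U \<noteq> {}" for n using that by blast
  have "is_arc (s 0)" using s arc by (simp add: in_shift_space)
  then obtain \<gamma> where \<gamma>: "arc \<gamma>" "path_image \<gamma> = s 0" by (auto simp: is_arc_def)
  have "(\<Inter>n. itinerary_set s n - U) \<noteq> {}"
  proof (rule nested_compact_in_arc(1)[OF \<gamma>(1)])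
    show "compact (itinerary_set s n - U)" for n
      using itinerary_set_continuum[OF s] assms(2) by (simp add: compact_diff)
    show "itinerary_set s n - U \<subseteq> path_image \<gamma>" for n
      using itinerary_set_subset \<gamma>(2) by blast
    show "itinerary_set s n - U \<subseteq> itinerary_set s m - U" if "m \<le> n" for m n
      using itinerary_set_antimono[OF that] by blast
  qed (rule ne)
  moreover have "(\<Inter>n. itinerary_set s n - U) = followers s - U"
    by (auto simp: followers_INT)
  ultimately show False using followers_eq[OF s] assms(3) by auto
qed

lemma continuous_coded_point:
  "continuous_map (Markov_shift_topology P (transition_matrix g)) euclidean coded_point"
  unfolding continuous_map_def
proof (intro conjI allI impI)
  fix U :: "'a set" assume "openin euclidean U"
  then have "open U" by simp
  let ?X = "Markov_shift_topology P (transition_matrix g)"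
  show "openin ?X {s \<in> topspace ?X. coded_point s \<in> U}"
  proof (subst openin_subopen, intro ballI)
    fix s assume "s \<in> {s \<in> topspace ?X. coded_point s \<in> U}"
    then have s: "s \<in> shift_space" "coded_point s \<in> U" by auto
    then obtain n where n: "itinerary_set s n \<subseteq> U" using itinerary_set_small \<open>open U\<close> by blast
    define W where "W = cylinder P (transition_matrix g) (map s [0..<Suc n])"
    have W: "s' \<in> W \<longleftrightarrow> s' \<in> shift_space \<and> (\<forall>k\<le>n. s' k = s k)" for s'
      by (auto simp: W_def cylinder_def less_Suc_eq_le simp del: upt_Suc)
    have "coded_point s' \<in> U" if "s' \<in> W" for s'
    proof -
      have "s' \<in> shift_space" "\<forall>k\<le>n. s' k = s k" using W[of s'] that by simp_all
      then have "\<forall>k\<le>n. (g ^^ k) (coded_point s') \<in> s k"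
        using coded_point_follows[of s'] by fastforce
      then have "coded_point s' \<in> itinerary_set s n" by (simp only: itinerary_set_def mem_Collect_eq)
      then show ?thesis using n by blast
    qed
    moreover have "openin ?X W"
      unfolding Markov_shift_topology_def by (rule topology_generated_by_Basis) (simp add: W_def)
    ultimately show "\<exists>T. openin ?X T \<and> s \<in> T \<and> T \<subseteq> {s \<in> topspace ?X. coded_point s \<in> U}"
      using s W by (intro exI[of _ W]) auto
  qed
qed simp

section \<open>Countably many codes for each point\<close>

text \<open>
  Since \<open>g\<close> maps ends of \<open>i\<close> to ends of \<open>g ` i\<close>, both \<open>j\<close> and \<open>k\<close> are initial pieces of the arc
  \<open>g ` i\<close> at the same end, so their interiors overlap.
\<close>

lemma next_arc_at_endpoint:
  assumes "i \<in> P" "j \<in> P" "k \<in> P" "y \<in> endpoints i"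
    and "j \<subseteq> g ` i" "k \<subseteq> g ` i" "g y \<in> j" "g y \<in> k"
  shows "j = k" and "g y \<in> endpoints j"
proof -
  have cont: "continuous_on i g" using continuous_on_subset[OF continuous subset[OF assms(1)]] .
  note image = is_arc_image[OF arc[OF assms(1)] cont inj_on_arc[OF assms(1)]]
  have "g y \<in> endpoints (g ` i)" using image(2) assms(4) by simp
  then obtain \<gamma> where \<gamma>: "arc \<gamma>" "path_image \<gamma> = g ` i" "\<gamma> 0 = g y"
    using arc_from_endpoint image(1) by metis
  obtain b where b: "0 < b" "\<gamma> 0 \<in> endpoints j" "arc_interior j = \<gamma> ` {0<..<b}"
    using subarc_at_start[OF \<gamma>(1) arc[OF assms(2)]] assms(5,7) \<gamma>(2,3) by metis
  obtain c where c: "0 < c" "arc_interior k = \<gamma> ` {0<..<c}"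
    using subarc_at_start[OF \<gamma>(1) arc[OF assms(3)]] assms(6,8) \<gamma>(2,3) by metis
  show "g y \<in> endpoints j" using b(2) \<gamma>(3) by simp
  have "\<gamma> (min b c / 2) \<in> arc_interior j" "\<gamma> (min b c / 2) \<in> arc_interior k"
    using b c by auto
  then show "j = k" using meets_interior[OF assms(2,3)] by (auto simp: arc_interior_def)
qed

lemma code_determined_from_endpoint:
  assumes "s \<in> shift_space" "s' \<in> shift_space" "coded_point s = coded_point s'"
    and "(g ^^ n) (coded_point s) \<in> endpoints (s n)" "s n = s' n"
  shows "s (n + m) = s' (n + m) \<and> (g ^^ (n + m)) (coded_point s) \<in> endpoints (s (n + m))"
proof (induction m)
  case (Suc m)
  let ?y = "(g ^^ (n + m)) (coded_point s)"
  have P: "s (n + m) \<in> P" "s (Suc (n + m)) \<in> P" "s' (Suc (n + m)) \<in> P"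
    using assms(1,2) by (simp_all add: in_shift_space)
  have cover: "s (Suc (n + m)) \<subseteq> g ` s (n + m)" "s' (Suc (n + m)) \<subseteq> g ` s (n + m)"
    using assms(1,2) Suc.IH unfolding in_shift_space by metis+
  have "g ?y \<in> s (Suc (n + m))" "g ?y \<in> s' (Suc (n + m))"
    using coded_point_follows[OF assms(1), of "Suc (n + m)"]
      coded_point_follows[OF assms(2), of "Suc (n + m)"] assms(3) by simp_all
  with next_arc_at_endpoint[OF P _ cover, of ?y] Suc.IH
  have "s (Suc (n + m)) = s' (Suc (n + m))" "g ?y \<in> endpoints (s (Suc (n + m)))" by blast+
  then show ?case by simp
qed (use assms in simp)

text \<open>
  The codes of \<open>x\<close> fall into two classes. Those for which the orbit stays in the arc interiors are all
  equal. Those for which the orbit is at an end of its arc at time \<open>n\<close> are determined by their first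
  \<open>n + 1\<close> symbols, so for each \<open>n\<close> they inject into the words over the countable alphabet \<open>P\<close>.
\<close>

lemma countable_fibre: "countable {s \<in> shift_space. coded_point s = x}"
proof -
  define E where "E n = {s \<in> shift_space. coded_point s = x \<and> (g ^^ n) x \<in> endpoints (s n)}" for n
  define I where "I = {s \<in> shift_space. coded_point s = x \<and> (\<forall>n. (g ^^ n) x \<in> arc_interior (s n))}"
  have "countable (E n)" for n
  proof -
    let ?w = "\<lambda>s. map s [0..<Suc n]"
    have "?w ` E n \<subseteq> lists P" by (auto simp: E_def in_shift_space)
    then have "countable (?w ` E n)"
      using countable_lists[OF countable_partition] countable_subset by blast
    moreover have "inj_on ?w (E n)"
    proof (rule inj_onI, rule ext)
      fix s s' k assume E: "s \<in> E n" "s' \<in> E n" and "?w s = ?w s'"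
      then have eq: "s k = s' k" if "k \<le> n" for k
        using that by (simp del: upt_Suc add: less_Suc_eq_le)
      show "s k = s' k"
      proof (cases "k \<le> n")
        case False
        then obtain m where "k = n + m" using le_Suc_ex[of n k] by auto
        then show ?thesis
          using code_determined_from_endpoint[of s s' n m] E eq by (simp add: E_def)
      qed (rule eq)
    qed
    ultimately show ?thesis by (rule countable_image_inj_on)
  qed
  moreover have "s = s'" if "s \<in> I" "s' \<in> I" for s s'
  proof
    fix n
    have "s n \<in> P" "s' n \<in> P" "(g ^^ n) x \<in> s n" "(g ^^ n) x \<in> arc_interior (s' n)"
      using that by (auto simp: I_def in_shift_space arc_interior_def)
    then show "s n = s' n" by (rule meets_interior)
  qed
  then have "countable I"
    by (metis countable_empty countable_insert countable_subset insertI1 subsetI)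
  moreover have "{s \<in> shift_space. coded_point s = x} \<subseteq> I \<union> (\<Union>n. E n)"
    using coded_point_follows by (auto simp: I_def E_def arc_interior_def)
  moreover have "countable (I \<union> (\<Union>n. E n))" using calculation by simp
  ultimately show ?thesis using countable_subset by blast
qed

section \<open>The coding\<close>

definition skeleton :: "'a set" where
  "skeleton = {x \<in> G. \<forall>i\<in>P. x \<notin> arc_interior i}"

lemma skeleton_subset: "skeleton \<subseteq> G"
  by (auto simp: skeleton_def)

lemma countable_endpoints: "i \<in> P \<Longrightarrow> countable (endpoints i)"
  using arc endpoints_path_image by (fastforce simp: is_arc_def)

lemma countable_skeleton: "countable skeleton"
proof -
  have "skeleton \<subseteq> (G - \<Union>P) \<union> (\<Union>i\<in>P. endpoints i)"
    by (auto simp: skeleton_def arc_interior_def)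
  moreover have "countable ((G - \<Union>P) \<union> (\<Union>i\<in>P. endpoints i))"
    using partition countable_endpoints countable_partition by (auto simp: tame_partition_def)
  ultimately show ?thesis by (rule countable_subset)
qed

lemma countable_preimage:
  assumes "countable B"
  shows "countable {x \<in> G. g x \<in> B}"
proof -
  have "{x \<in> G. g x \<in> B} \<subseteq> (G - \<Union>P) \<union> (\<Union>i\<in>P. i \<inter> g -` B)" by auto
  moreover have "countable ((G - \<Union>P) \<union> (\<Union>i\<in>P. i \<inter> g -` B))"
    using partition assms inj_on_arc
    by (intro countable_Un countable_UN countable_partition countable_image_inj_Int_vimage)
      (auto simp: tame_partition_def)
  ultimately show ?thesis by (rule countable_subset)
qed

definition code :: "'a \<Rightarrow> nat \<Rightarrow> 'a set" where
  "code x n = (THE i. i \<in> P \<and> (g ^^ n) x \<in> arc_interior i)"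

lemma code_eqI: "i \<in> P \<Longrightarrow> (g ^^ n) x \<in> arc_interior i \<Longrightarrow> code x n = i"
  unfolding code_def by (rule the_equality) (auto simp: arc_interior_def dest: meets_interior)

lemma code_shift: "code (g x) = left_shift (code x)"
  by (rule ext) (simp add: code_def left_shift_def funpow_swap1)

text \<open>
  Continuity of \<open>code\<close> on the complement of \<open>N\<close> comes from the openness of the arc interiors: there
  the first symbols of the code are locally constant.
\<close>

lemma isomorphic_to_shift:
  "isomorphic_mod_countable (top_of_set G) g (Markov_shift_topology P (transition_matrix g)) left_shift"
proof -
  obtain N where N: "skeleton \<subseteq> N" "countable N" "totally_invariant G g N"
    using totally_invariant_hull[OF maps _ countable_skeleton countable_preimage] skeleton_subset by blast
  have N_iff: "g x \<in> N \<longleftrightarrow> x \<in> N" if "x \<in> G" for x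
    using N(3) that unfolding totally_invariant_def by blast
  define N' where "N' = {s \<in> shift_space. coded_point s \<in> N}"
  let ?D = "G - N" and ?X = "Markov_shift_topology P (transition_matrix g)"
  have orbit: "(g ^^ n) x \<in> ?D" if "x \<in> ?D" for x n
    using that N_iff funpow_in maps by (induction n) auto
  have code: "code x n \<in> P \<and> (g ^^ n) x \<in> arc_interior (code x n)" if "x \<in> ?D" for x n
  proof -
    have "(g ^^ n) x \<in> G - skeleton" using orbit[OF that, of n] N(1) by blast
    then obtain i where "i \<in> P" "(g ^^ n) x \<in> arc_interior i" by (auto simp: skeleton_def)
    then show ?thesis using code_eqI by simp
  qed
  have code_follows: "x \<in> followers (code x)" if "x \<in> ?D" for x
    using code[OF that] by (auto simp: followers_def arc_interior_def)
  have code_in: "code x \<in> shift_space" if "x \<in> ?D" for x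
    unfolding in_shift_space
  proof (intro conjI allI)
    fix n
    show "code x n \<in> P" using code[OF that] by blast
    show "code x (Suc n) \<subseteq> g ` code x n"
      using code[OF that, of n] code[OF that, of "Suc n"]
      by (intro image_covers[of _ _ "(g ^^ n) x"]) (auto simp: arc_interior_def)
  qed
  have left_inverse: "coded_point (code x) = x" if "x \<in> ?D" for x
    using coded_point_eqI code_in code_follows that by blast
  have right_inverse: "code (coded_point s) = s" if "s \<in> shift_space - N'" for s
  proof
    fix n
    have s: "s \<in> shift_space" "coded_point s \<in> ?D"
      using that coded_point_in by (auto simp: N'_def)
    then show "code (coded_point s) n = s n"
      using code[OF s(2), of n] coded_point_follows[OF s(1), of n]
      by (intro meets_interior[symmetric]) (auto simp: in_shift_space)
  qed
  have code_open: "openin (top_of_set ?D) {x \<in> ?D. code x k = i}" for k i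
  proof (cases "i \<in> P")
    case True
    have "continuous_on ?D (g ^^ k)" by (rule continuous_on_subset[OF continuous_funpow]) auto
    moreover have "(g ^^ k) \<in> ?D \<rightarrow> G" using funpow_in by auto
    ultimately have "openin (top_of_set ?D) (?D \<inter> (g ^^ k) -` arc_interior i)"
      using open_interior[OF True] by (rule continuous_openin_preimage)
    moreover have "?D \<inter> (g ^^ k) -` arc_interior i = {x \<in> ?D. code x k = i}"
      using code code_eqI[OF True] by auto
    ultimately show ?thesis by simp
  next
    case False
    then have "{x \<in> ?D. code x k = i} = {}" using code by blast
    then show ?thesis by (simp only: openin_empty)
  qed
  have "continuous_map (top_of_set ?D) ?X code"
    unfolding Markov_shift_topology_def
  proof (rule continuous_on_generated_topo)
    fix W assume "W \<in> range (cylinder P (transition_matrix g))"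
    then obtain w where W: "W = cylinder P (transition_matrix g) w" by blast
    have "openin (top_of_set ?D) {x \<in> ?D. \<forall>k<n. code x k = w ! k}" for n
    proof (induction n)
      case 0
      have "{x \<in> ?D. \<forall>k<0. code x k = w ! k} = ?D" by blast
      then show ?case using openin_topspace[of "top_of_set ?D"] by (simp only: topspace_euclidean_subtopology)
    next
      case (Suc n)
      have "{x \<in> ?D. \<forall>k<Suc n. code x k = w ! k} =
          {x \<in> ?D. \<forall>k<n. code x k = w ! k} \<inter> {x \<in> ?D. code x n = w ! n}"
        by (auto simp: less_Suc_eq)
      then show ?case using Suc code_open by (simp add: openin_Int)
    qed
    moreover have "code -` W \<inter> topspace (top_of_set ?D) = {x \<in> ?D. \<forall>k<length w. code x k = w ! k}"
      using code_in by (auto simp: W cylinder_def)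
    ultimately show "openin (top_of_set ?D) (code -` W \<inter> topspace (top_of_set ?D))" by simp
  next
    show "code ` topspace (top_of_set ?D) \<subseteq> \<Union> (range (cylinder P (transition_matrix g)))"
      using code_in by (auto simp: cylinder_def intro!: exI[of _ "[]"])
  qed
  moreover have "code x \<notin> N'" if "x \<in> ?D" for x
    using left_inverse that by (simp add: N'_def)
  ultimately have "continuous_map (top_of_set ?D) (subtopology ?X (shift_space - N')) code"
    using code_in by (auto simp: continuous_map_in_subtopology)
  moreover have "continuous_map (subtopology ?X (shift_space - N')) (top_of_set ?D) coded_point"
    using continuous_coded_point coded_point_in
    by (auto simp: continuous_map_in_subtopology N'_def intro: continuous_map_from_subtopology)
  ultimately have hom: "homeomorphic_maps (top_of_set ?D) (subtopology ?X (shift_space - N')) code coded_point"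
    using left_inverse right_inverse by (auto simp: homeomorphic_maps_def)
  have "N' = (\<Union>x\<in>N. {s \<in> shift_space. coded_point s = x})" by (auto simp: N'_def)
  then have "countable N'" using N(2) countable_fibre by simp
  moreover have "totally_invariant shift_space left_shift N'"
    using N_iff coded_point_left_shift coded_point_in left_shift_in_shift_space
    by (auto simp: totally_invariant_def N'_def)
  moreover have "subtopology (top_of_set G) (G - N) = top_of_set ?D"
    by (simp add: subtopology_subtopology Int_absorb1)
  ultimately show ?thesis
    using N(2,3) hom code_shift
    by (intro isomorphic_mod_countableI[of N _ _ N' _ _ code coded_point]) auto
qed

end

theorem theorem8p4:
  fixes G :: "'a::metric_space set" and g :: "'a \<Rightarrow> 'a" and P :: "'a set set"
    and M :: "'a set \<Rightarrow> 'a set \<Rightarrow> nat"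
  assumes "tame_graph G"
    and "continuous_on G g" and "g \<in> G \<rightarrow> G"
    and "mixing_on G g"
    and "countable_Markov_partition G g P"
    and "M = transition_matrix g"
  shows "isomorphic_mod_countable (top_of_set G) g (Markov_shift_topology P M) left_shift"
proof -
  interpret mixing_Markov_map G g P
    by unfold_locales (use assms in auto)
  show ?thesis using isomorphic_to_shift assms(6) by simp
qed

end
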